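(* There is a static one-dimensional Euclidean profile for which no sequence satisfies rank-JR and no sequence satisfies rank-PSC. Hence, rank-PJR cannot always be satisfied either (there is a profile for which no sequence satisfies rank-PJR).
   Context: Model. Voters $V=[n]$, a set $C$ of $m$ candidates, rounds $T=\{1,\dots,|T|\}$ with $n,m,|T|\ge1$. In each round $j$ each voter $i$ has a strict complete ranking of $C$; together these form the profile, which is static if the rankings are the same in all rounds. A profile is one-dimensional Euclidean if, in each round, voters and candidates can be placed on the real line so that every voter ranks candidates by increasing distance from her position, with no ties in distance. $A_i^j(r)$ is the set of voter $i$'s $r$ most-preferred candidates in round $j$, for $r\in[m]$. A sequence is $W=(w^1,\dots,w^{|T|})\in C^{|T|}$. A group is a nonempty $S\subseteq V$. A rank vector is $\mathbf r=(r^1,\dots,r^{|T|})\in[m]^{|T|}$. Under $\mathbf r$, $S$ agrees in round $j$ if $\bigcap_{i\in S}A_i^j(r^j)\ne\varnothing$; $S$ is solid in round $j$ if $|\bigcap_{i\in S}A_i^j(r^j)|=r^j$ (all members have the same approval set); $S$ is represented in round $j$ if $w^j\in\bigcup_{i\in S}A_i^j(r^j)$. $W$ satisfies rank-PJR if for every rank vector $\mathbf r$, every positive integer $\ell$, and every group $S$ that agrees in $k>0$ rounds under $\mathbf r$ with $|S|\ge\ell n/k$, $S$ is represented in at least $\ell$ rounds. Rank-JR: the same, with the conclusion that $S$ is represented in at least one round. Rank-PSC: the same as rank-PJR with "agrees" replaced by "is solid" (representation is still counted over all rounds). *)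

theory Defs
  imports Complex_Main "HOL-Combinatorics.Multiset_Permutations"
begin

text \<open>
  An election is given by the number n of voters (the voters are 1, ..., n), the set C of
  candidates, the number t of rounds (the rounds are 1, ..., t) and a profile P, where P j i lists
  the candidates in the order in which voter i ranks them in round j, most preferred first.
  Values of P (and of sequences and rank vectors below) outside these ranges are irrelevant.
\<close>

type_synonym 'c profile = "nat \<Rightarrow> nat \<Rightarrow> 'c list"

definition election :: "nat \<Rightarrow> 'c set \<Rightarrow> nat \<Rightarrow> 'c profile \<Rightarrow> bool" where
  "election n C t P \<longleftrightarrow>
     n \<ge> 1 \<and> finite C \<and> C \<noteq> {} \<and> t \<ge> 1 \<and>
     (\<forall>j\<in>{1..t}. \<forall>i\<in>{1..n}. P j i \<in> permutations_of_set C)"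

definition static :: "nat \<Rightarrow> nat \<Rightarrow> 'c profile \<Rightarrow> bool" where
  "static n t P \<longleftrightarrow> (\<forall>j\<in>{1..t}. \<forall>j'\<in>{1..t}. \<forall>i\<in>{1..n}. P j i = P j' i)"

text \<open>
  x and y are the positions of the voters and of the candidates; the strict inequality excludes
  ties in distance.
\<close>

definition euclidean_1d :: "nat \<Rightarrow> nat \<Rightarrow> 'c profile \<Rightarrow> bool" where
  "euclidean_1d n t P \<longleftrightarrow>
     (\<forall>j\<in>{1..t}. \<exists>(x :: nat \<Rightarrow> real) (y :: 'c \<Rightarrow> real). \<forall>i\<in>{1..n}.
        sorted_wrt (\<lambda>a b. \<bar>x i - y a\<bar> < \<bar>x i - y b\<bar>) (P j i))"

definition approval :: "'c profile \<Rightarrow> nat \<Rightarrow> nat \<Rightarrow> nat \<Rightarrow> 'c set" where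
  "approval P j i r = set (take r (P j i))"

definition is_sequence :: "'c set \<Rightarrow> nat \<Rightarrow> (nat \<Rightarrow> 'c) \<Rightarrow> bool" where
  "is_sequence C t W \<longleftrightarrow> (\<forall>j\<in>{1..t}. W j \<in> C)"

definition rank_vector :: "'c set \<Rightarrow> nat \<Rightarrow> (nat \<Rightarrow> nat) \<Rightarrow> bool" where
  "rank_vector C t r \<longleftrightarrow> (\<forall>j\<in>{1..t}. r j \<in> {1..card C})"

definition is_group :: "nat \<Rightarrow> nat set \<Rightarrow> bool" where
  "is_group n S \<longleftrightarrow> S \<noteq> {} \<and> S \<subseteq> {1..n}"

definition agrees :: "'c profile \<Rightarrow> (nat \<Rightarrow> nat) \<Rightarrow> nat set \<Rightarrow> nat \<Rightarrow> bool" where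
  "agrees P r S j \<longleftrightarrow> (\<Inter>i\<in>S. approval P j i (r j)) \<noteq> {}"

definition solid :: "'c profile \<Rightarrow> (nat \<Rightarrow> nat) \<Rightarrow> nat set \<Rightarrow> nat \<Rightarrow> bool" where
  "solid P r S j \<longleftrightarrow> card (\<Inter>i\<in>S. approval P j i (r j)) = r j"

definition represented ::
  "'c profile \<Rightarrow> (nat \<Rightarrow> 'c) \<Rightarrow> (nat \<Rightarrow> nat) \<Rightarrow> nat set \<Rightarrow> nat \<Rightarrow> bool" where
  "represented P W r S j \<longleftrightarrow> W j \<in> (\<Union>i\<in>S. approval P j i (r j))"

definition rank_PJR :: "nat \<Rightarrow> 'c set \<Rightarrow> nat \<Rightarrow> 'c profile \<Rightarrow> (nat \<Rightarrow> 'c) \<Rightarrow> bool" where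
  "rank_PJR n C t P W \<longleftrightarrow>
     (\<forall>r l S k. rank_vector C t r \<and> l > 0 \<and> is_group n S \<and>
        k = card {j \<in> {1..t}. agrees P r S j} \<and> k > 0 \<and>
        real (card S) \<ge> real l * real n / real k \<longrightarrow>
        card {j \<in> {1..t}. represented P W r S j} \<ge> l)"

definition rank_JR :: "nat \<Rightarrow> 'c set \<Rightarrow> nat \<Rightarrow> 'c profile \<Rightarrow> (nat \<Rightarrow> 'c) \<Rightarrow> bool" where
  "rank_JR n C t P W \<longleftrightarrow>
     (\<forall>r l S k. rank_vector C t r \<and> l > 0 \<and> is_group n S \<and>
        k = card {j \<in> {1..t}. agrees P r S j} \<and> k > 0 \<and>
        real (card S) \<ge> real l * real n / real k \<longrightarrow>
        card {j \<in> {1..t}. represented P W r S j} \<ge> 1)"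

definition rank_PSC :: "nat \<Rightarrow> 'c set \<Rightarrow> nat \<Rightarrow> 'c profile \<Rightarrow> (nat \<Rightarrow> 'c) \<Rightarrow> bool" where
  "rank_PSC n C t P W \<longleftrightarrow>
     (\<forall>r l S k. rank_vector C t r \<and> l > 0 \<and> is_group n S \<and>
        k = card {j \<in> {1..t}. solid P r S j} \<and> k > 0 \<and>
        real (card S) \<ge> real l * real n / real k \<longrightarrow>
        card {j \<in> {1..t}. represented P W r S j} \<ge> l)"

end

(*
  Twelve voters form two distant clusters of six, each voter standing at her own favourite
  candidate, and there are five rounds. Some cluster D receives at most two of the five winners.
  Let S be the members of D whose favourite never wins, so |S| >= 4. Ask for rank 6, the whole of D,
  in the at least three rounds whose winner lies outside D, and for rank 1 in the other rounds. Then
  S is solid in k >= 3 rounds and |S| >= n/k, but S is never represented.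
*)

theory Submission
  imports Defs
begin

(* Powers of two have no three-term arithmetic progression, so no voter sees a tie in her cluster;
   the offset puts the other cluster beyond all distances within the cluster. *)
definition pos :: "nat \<Rightarrow> int" where
  "pos i = (if i \<le> 6 then 2 ^ i else 1000 + 2 ^ (i - 6))"

text \<open>Integer positions keep the sort executable, so its properties can be checked by
  evaluation for all twelve voters; the positions are embedded into the reals only for
  \<open>euclidean_1d\<close>.\<close>

definition ranking :: "nat \<Rightarrow> nat list" where
  "ranking i = sort_key (\<lambda>a. \<bar>pos i - pos a\<bar>) [1..<13]"

definition cluster_profile :: "nat profile" where
  "cluster_profile j i = ranking i"

lemma ranking_strict:
  assumes "i \<in> {1..12}"
  shows "sorted_wrt (\<lambda>a b. \<bar>pos i - pos a\<bar> < \<bar>pos i - pos b\<bar>) (ranking i)"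
proof -
  have "\<forall>i\<in>set [1..<13]. sorted_wrt (\<lambda>a b. \<bar>pos i - pos a\<bar> < \<bar>pos i - pos b\<bar>) (ranking i)"
    by code_simp
  with assms show ?thesis by simp
qed

lemma take_1_ranking:
  assumes "i \<in> {1..12}"
  shows "take 1 (ranking i) = [i]"
proof -
  have "\<forall>i\<in>set [1..<13]. take 1 (ranking i) = [i]"
    by code_simp
  with assms show ?thesis by simp
qed

text \<open>Each cluster has diameter 62, while the gap between the clusters is 938.\<close>

lemma set_take_6_ranking:
  assumes "D = {1..6} \<or> D = {7..12}" and "i \<in> D"
  shows "set (take 6 (ranking i)) = D"
proof -
  have "\<forall>i\<in>set [1..<7]. set (take 6 (ranking i)) = set [1..<7]"
    by code_simp
  moreover have "\<forall>i\<in>set [7..<13]. set (take 6 (ranking i)) = set [7..<13]"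
    by code_simp
  moreover have "set [1..<7] = {1..6::nat}" "set [7..<13] = {7..12::nat}" by auto
  ultimately show ?thesis using assms by metis
qed

lemma election_cluster_profile: "election 12 {1..12} 5 cluster_profile"
proof -
  have "set [1..<13] = {1..12::nat}" by auto
  then show ?thesis
    by (simp add: election_def cluster_profile_def ranking_def permutations_of_set_def
        del: upt_rec_numeral)
qed

lemma static_cluster_profile: "static n t cluster_profile"
  by (simp add: static_def cluster_profile_def)

lemma euclidean_1d_cluster_profile: "euclidean_1d 12 t cluster_profile"
  unfolding euclidean_1d_def
proof
  fix j
  have "sorted_wrt (\<lambda>a b. \<bar>real_of_int (pos i) - pos a\<bar> < \<bar>real_of_int (pos i) - pos b\<bar>)
          (cluster_profile j i)" if "i \<in> {1..12}" for i
    unfolding cluster_profile_def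
  proof (rule sorted_wrt_mono_rel[OF _ ranking_strict[OF that]])
    fix a b
    assume "\<bar>pos i - pos a\<bar> < \<bar>pos i - pos b\<bar>"
    then have "real_of_int \<bar>pos i - pos a\<bar> < real_of_int \<bar>pos i - pos b\<bar>"
      by (simp only: of_int_less_iff)
    then show "\<bar>real_of_int (pos i) - pos a\<bar> < \<bar>real_of_int (pos i) - pos b\<bar>"
      by simp
  qed
  then show "\<exists>(x :: nat \<Rightarrow> real) (y :: nat \<Rightarrow> real). \<forall>i\<in>{1..12}.
      sorted_wrt (\<lambda>a b. \<bar>x i - y a\<bar> < \<bar>x i - y b\<bar>) (cluster_profile j i)"
    by (intro exI[of _ "\<lambda>i. real_of_int (pos i)"] ballI)
qed

text \<open>Pigeonhole: three winners in each cluster would need six rounds.\<close>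

lemma underrepresented_cluster:
  fixes W :: "nat \<Rightarrow> nat"
  obtains D where "D = {1..6} \<or> D = {7..12}" and "card {j \<in> {1..5::nat}. W j \<in> D} \<le> 2"
proof -
  let ?R = "\<lambda>D. {j \<in> {1..5::nat}. W j \<in> D}"
  have "card (?R {1..6}) + card (?R {7..12}) = card (?R {1..6} \<union> ?R {7..12})"
    by (rule card_Un_disjoint[symmetric]) auto
  also have "\<dots> \<le> card {1..5::nat}"
    by (rule card_mono) auto
  finally have "card (?R {1..6}) \<le> 2 \<or> card (?R {7..12}) \<le> 2" by auto
  with that show thesis by blast
qed

text \<open>A common counterexample for both axioms, with \<open>l = 1\<close>. It is phrased with
  \<open>solid\<close> because, at positive ranks, solidity implies agreement. The quota is kept as
  a product of naturals to avoid division.\<close>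

lemma unrepresented_solid_group:
  fixes W :: "nat \<Rightarrow> nat"
  obtains r S where
    "rank_vector {1..12::nat} 5 r" and "is_group 12 S"
    and "12 \<le> card S * card {j \<in> {1..5}. solid cluster_profile r S j}"
    and "{j \<in> {1..5}. represented cluster_profile W r S j} = {}"
proof -
  obtain D where D: "D = {1..6} \<or> D = {7..12}" and few: "card {j \<in> {1..5::nat}. W j \<in> D} \<le> 2"
    by (rule underrepresented_cluster)
  \<comment> \<open>Voters and candidates share labels and voter \<open>i\<close> ranks candidate
    \<open>i\<close> first, so a set of winners can be subtracted from a set of voters.\<close>
  define S where "S = D - W ` {j \<in> {1..5}. W j \<in> D}"
  define r :: "nat \<Rightarrow> nat" where "r j = (if W j \<in> D then 1 else 6)" for j
  have D_sub: "D \<subseteq> {1..12}" and card_D: "card D = 6" using D by auto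
  have "card (W ` {j \<in> {1..5::nat}. W j \<in> D}) \<le> 2"
    using card_image_le[of "{j \<in> {1..5::nat}. W j \<in> D}" W] few by simp
  moreover have "card D - card (W ` {j \<in> {1..5::nat}. W j \<in> D}) \<le> card S"
    unfolding S_def by (rule diff_card_le_card_Diff) simp
  ultimately have card_S: "4 \<le> card S" using card_D by simp
  then have S_ne: "S \<noteq> {}" by auto
  have approval_6: "approval cluster_profile j i 6 = D" if "i \<in> S" for i j
    using that set_take_6_ranking[OF D]
    by (simp add: S_def approval_def cluster_profile_def)
  have approval_1: "approval cluster_profile j i 1 = {i}" if "i \<in> S" for i j
  proof -
    have "i \<in> {1..12}" using that D_sub by (auto simp: S_def)
    from take_1_ranking[OF this] show ?thesis
      by (simp add: approval_def cluster_profile_def)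
  qed
  have "{1..5::nat} = {j \<in> {1..5}. W j \<in> D} \<union> {j \<in> {1..5}. W j \<notin> D}" by auto
  then have "card {1..5::nat} \<le> card {j \<in> {1..5::nat}. W j \<in> D} + card {j \<in> {1..5::nat}. W j \<notin> D}"
    using card_Un_le by metis
  then have "3 \<le> card {j \<in> {1..5::nat}. W j \<notin> D}" using few by simp
  also have "\<dots> \<le> card {j \<in> {1..5}. solid cluster_profile r S j}"
  proof (rule card_mono)
    \<comment> \<open>In these rounds the intersection runs over copies of \<open>D\<close>; as
      \<open>S\<close> is nonempty it equals \<open>D\<close>, whose size 6 is the rank.\<close>
    show "{j \<in> {1..5}. W j \<notin> D} \<subseteq> {j \<in> {1..5}. solid cluster_profile r S j}"
      using S_ne by (auto simp: solid_def r_def approval_6 card_D)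
  qed simp
  \<comment> \<open>Four voters times three rounds meet the quota of 12 exactly.\<close>
  finally have "4 * 3 \<le> card S * card {j \<in> {1..5}. solid cluster_profile r S j}"
    using card_S by (intro mult_le_mono)
  then have quota: "12 \<le> card S * card {j \<in> {1..5}. solid cluster_profile r S j}"
    by simp
  have rank: "rank_vector {1..12::nat} 5 r"
    by (simp add: rank_vector_def r_def)
  have grp: "is_group 12 S"
    using S_ne D_sub by (auto simp: is_group_def S_def)
  have "\<not> represented cluster_profile W r S j" if "j \<in> {1..5}" for j
  proof (cases "W j \<in> D")
    case True
    \<comment> \<open>At rank 1 the approval sets of the members unite to \<open>S\<close>
      itself.\<close>
    with that have "W j \<notin> S" by (auto simp: S_def)
    with True approval_1 show ?thesis by (auto simp: represented_def r_def)
  next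
    case False
    with approval_6 show ?thesis by (auto simp: represented_def r_def)
  qed
  then have "{j \<in> {1..5}. represented cluster_profile W r S j} = {}" by blast
  with rank grp quota show thesis by (rule that)
qed

text \<open>The intersection has positive cardinality, hence is nonempty.\<close>

lemma solid_imp_agrees:
  assumes "solid P r S j" and "r j > 0"
  shows "agrees P r S j"
  using assms by (auto simp: solid_def agrees_def)

lemma real_quota:
  fixes s k n :: nat
  assumes "n \<le> s * k" and "k > 0"
  shows "real 1 * real n / real k \<le> real s"
proof -
  have "real n \<le> real s * real k" using assms(1) by (metis of_nat_le_iff of_nat_mult)
  with assms(2) show ?thesis by (simp add: divide_le_eq)
qed

lemma rank_PJR_imp_rank_JR:
  assumes "rank_PJR n C t P W"
  shows "rank_JR n C t P W"
  unfolding rank_JR_def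
proof (intro allI impI)
  fix r l S k
  assume prems: "rank_vector C t r \<and> l > 0 \<and> is_group n S \<and>
    k = card {j \<in> {1..t}. agrees P r S j} \<and> k > 0 \<and> real (card S) \<ge> real l * real n / real k"
  with assms have "l \<le> card {j \<in> {1..t}. represented P W r S j}"
    unfolding rank_PJR_def by blast
  with prems show "1 \<le> card {j \<in> {1..t}. represented P W r S j}" by linarith
qed

lemma not_rank_JR_cluster_profile: "\<not> rank_JR 12 {1..12} 5 cluster_profile W"
proof
  assume JR: "rank_JR 12 {1..12} 5 cluster_profile W"
  obtain r S where r: "rank_vector {1..12::nat} 5 r" and S: "is_group 12 S"
    and le: "12 \<le> card S * card {j \<in> {1..5}. solid cluster_profile r S j}"
    and unrep: "{j \<in> {1..5}. represented cluster_profile W r S j} = {}"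
    by (rule unrepresented_solid_group)
  define k where "k = card {j \<in> {1..5}. agrees cluster_profile r S j}"
  have "r j > 0" if "j \<in> {1..5}" for j using r that by (force simp: rank_vector_def)
  then have "{j \<in> {1..5}. solid cluster_profile r S j} \<subseteq> {j \<in> {1..5}. agrees cluster_profile r S j}"
    using solid_imp_agrees by blast
  \<comment> \<open>Further rounds of agreement only increase \<open>k\<close> and so lower the
    required group size \<open>n / k\<close>.\<close>
  then have "card {j \<in> {1..5}. solid cluster_profile r S j} \<le> k"
    unfolding k_def by (intro card_mono) simp
  with le have le_k: "12 \<le> card S * k" by (meson le_trans mult_le_mono2)
  then have "k > 0" by (cases k) auto
  with r S k_def real_quota[OF le_k]
  have "1 \<le> card {j \<in> {1..5}. represented cluster_profile W r S j}"
    by (intro JR[unfolded rank_JR_def, rule_format, where l = 1]) simp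
  then show False unfolding unrep by simp
qed

lemma not_rank_PSC_cluster_profile: "\<not> rank_PSC 12 {1..12} 5 cluster_profile W"
proof
  assume PSC: "rank_PSC 12 {1..12} 5 cluster_profile W"
  obtain r S where r: "rank_vector {1..12::nat} 5 r" and S: "is_group 12 S"
    and le: "12 \<le> card S * card {j \<in> {1..5}. solid cluster_profile r S j}"
    and unrep: "{j \<in> {1..5}. represented cluster_profile W r S j} = {}"
    by (rule unrepresented_solid_group)
  define k where "k = card {j \<in> {1..5}. solid cluster_profile r S j}"
  from le have le_k: "12 \<le> card S * k" by (simp add: k_def)
  then have "k > 0" by (cases k) auto
  with r S k_def real_quota[OF le_k]
  have "1 \<le> card {j \<in> {1..5}. represented cluster_profile W r S j}"
    by (intro PSC[unfolded rank_PSC_def, rule_format, where l = 1]) simp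
  then show False unfolding unrep by simp
qed

theorem theorem4p2:
  shows "(\<exists>(n :: nat) (C :: nat set) (t :: nat) (P :: nat profile).
            election n C t P \<and> static n t P \<and> euclidean_1d n t P \<and>
            \<not> (\<exists>W. is_sequence C t W \<and> rank_JR n C t P W) \<and>
            \<not> (\<exists>W. is_sequence C t W \<and> rank_PSC n C t P W))
       \<and> (\<exists>(n :: nat) (C :: nat set) (t :: nat) (P :: nat profile).
            election n C t P \<and>
            \<not> (\<exists>W. is_sequence C t W \<and> rank_PJR n C t P W))"
  using election_cluster_profile static_cluster_profile euclidean_1d_cluster_profile
    not_rank_JR_cluster_profile not_rank_PSC_cluster_profile rank_PJR_imp_rank_JR
  by meson

end
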